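(* There exists a finitely generated group $G$ for which neither of the sequences $$H^2_b(G,\mathbb{R}) \xrightarrow{\ c^2\ } H^2(G,\mathbb{R}) \xrightarrow{\ \iota^2\ } H^2_{(\infty)}(G,\mathbb{R})$$ and $$H^2_b(G,\mathbb{Z}) \xrightarrow{\ c^2\ } H^2(G,\mathbb{Z}) \xrightarrow{\ \iota^2\ } H^2_{(\infty)}(G,\mathbb{Z})$$ is exact.
   Context: Let $A=\mathbb{Z}$ or $\mathbb{R}$ (trivial coefficients). $C^*(G,A)$ is the inhomogeneous bar complex of $G$; the bounded cochains (maps $G^n\to A$ with bounded image) form a subcomplex $C^*_b(G,A)$ with cohomology $H^*_b(G,A)$, and the inclusion induces the comparison map $c^*\colon H^*_b(G,A)\to H^*(G,A)$. $\ell^\infty(G,A)$ is the module of bounded functions $G\to A$, with the left $G$-action $(g\cdot f)(h)=f(g^{-1}h)$. $H^*_{(\infty)}(G,A)$ is the cohomology of the bar complex $C^*(G,\ell^\infty(G,A))$ with twisted coefficients. The inclusion of $A$ into $\ell^\infty(G,A)$ as constant functions induces $\iota^*\colon H^*(G,A)\to H^*_{(\infty)}(G,A)$. *)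

theory Defs
  imports Complex_Main "HOL-Algebra.Coset" "HOL-Algebra.Generated_Groups" "HOL-Library.Function_Algebras"
begin

definition finitely_generated_group :: "('g, 'b) monoid_scheme \<Rightarrow> bool" where
  "finitely_generated_group G \<longleftrightarrow>
     group G \<and> (\<exists>S. finite S \<and> S \<subseteq> carrier G \<and> generate G S = carrier G)"

definition additive_group :: "'c::ab_group_add set \<Rightarrow> 'c monoid" where
  "additive_group S = \<lparr>carrier = S, monoid.mult = (+), one = 0\<rparr>"


subsection \<open>Cohomology of a cochain complex\<close>

text \<open>A cochain complex is given by the additive subgroups \<open>C n\<close> of an ambient abelian group and
  the differentials \<open>d n\<close> from \<open>C n\<close> to \<open>C (Suc n)\<close>.\<close>

definition cocycles :: "(nat \<Rightarrow> 'c::ab_group_add set) \<Rightarrow> (nat \<Rightarrow> 'c \<Rightarrow> 'c) \<Rightarrow> nat \<Rightarrow> 'c set" where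
  "cocycles C d n = {f \<in> C n. d n f = 0}"

definition coboundaries :: "(nat \<Rightarrow> 'c::ab_group_add set) \<Rightarrow> (nat \<Rightarrow> 'c \<Rightarrow> 'c) \<Rightarrow> nat \<Rightarrow> 'c set" where
  "coboundaries C d n = (case n of 0 \<Rightarrow> {0} | Suc m \<Rightarrow> d m ` C m)"

definition cohomology ::
    "(nat \<Rightarrow> 'c::ab_group_add set) \<Rightarrow> (nat \<Rightarrow> 'c \<Rightarrow> 'c) \<Rightarrow> nat \<Rightarrow> 'c set monoid" where
  "cohomology C d n = additive_group (cocycles C d n) Mod coboundaries C d n"

text \<open>A cochain map \<open>\<phi>\<close> into the complex \<open>(D, d)\<close> sends the class \<open>z + B\<close> to \<open>\<phi> z + B'\<close>, where
  \<open>B'\<close> are the coboundaries of the target. As \<open>\<phi>\<close> maps \<open>B\<close> into \<open>B'\<close>, this class is the sum of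
  the sets \<open>B'\<close> and \<open>\<phi> ` (z + B)\<close>.\<close>

definition induced_map ::
    "('c \<Rightarrow> 'e) \<Rightarrow> (nat \<Rightarrow> 'e::ab_group_add set) \<Rightarrow> (nat \<Rightarrow> 'e \<Rightarrow> 'e) \<Rightarrow> nat \<Rightarrow> 'c set \<Rightarrow> 'e set" where
  "induced_map \<phi> D d n X = coboundaries D d n <#>\<^bsub>additive_group (cocycles D d n)\<^esub> (\<phi> ` X)"

definition exact_at ::
    "('a, 'p) monoid_scheme \<Rightarrow> ('a \<Rightarrow> 'b) \<Rightarrow> ('b, 'q) monoid_scheme \<Rightarrow> ('b \<Rightarrow> 'c)
      \<Rightarrow> ('c, 'r) monoid_scheme \<Rightarrow> bool" where
  "exact_at K f L g M \<longleftrightarrow> f ` carrier K = kernel L M g"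


subsection \<open>The inhomogeneous bar complex\<close>

definition tuples :: "('g, 'b) monoid_scheme \<Rightarrow> nat \<Rightarrow> 'g list set" where
  "tuples G n = {xs. length xs = n \<and> set xs \<subseteq> carrier G}"

text \<open>The coefficient module has underlying set \<open>V\<close>. Maps from the \<open>n\<close>-fold power of the group
  to \<open>V\<close> are represented by functions on lists that vanish on all other lists.\<close>

definition cochains :: "('g, 'b) monoid_scheme \<Rightarrow> 'm::ab_group_add set \<Rightarrow> nat \<Rightarrow> ('g list \<Rightarrow> 'm) set" where
  "cochains G V n = {f. (\<forall>xs \<in> tuples G n. f xs \<in> V) \<and> (\<forall>xs. xs \<notin> tuples G n \<longrightarrow> f xs = 0)}"

definition merge_at :: "('g, 'b) monoid_scheme \<Rightarrow> nat \<Rightarrow> 'g list \<Rightarrow> 'g list" where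
  "merge_at G i xs = take i xs @ (xs ! i \<otimes>\<^bsub>G\<^esub> xs ! Suc i) # drop (i + 2) xs"

definition signed :: "nat \<Rightarrow> 'm::ab_group_add \<Rightarrow> 'm" where
  "signed k x = (if even k then x else - x)"

text \<open>For \<open>xs = [g\<^sub>1, \<dots>, g\<^sub>n\<^sub>+\<^sub>1]\<close> the summands are
  \<open>g\<^sub>1 \<cdot> f (g\<^sub>2, \<dots>, g\<^sub>n\<^sub>+\<^sub>1)\<close>, then \<open>(-1)\<^sup>i f (\<dots>, g\<^sub>i g\<^sub>i\<^sub>+\<^sub>1, \<dots>)\<close> for \<open>1 \<le> i \<le> n\<close>, and
  \<open>(-1)\<^sup>n\<^sup>+\<^sup>1 f (g\<^sub>1, \<dots>, g\<^sub>n)\<close>; list positions are counted from 0, so the index below is \<open>i - 1\<close>.\<close>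

definition bar_diff ::
    "('g, 'b) monoid_scheme \<Rightarrow> ('g \<Rightarrow> 'm \<Rightarrow> 'm) \<Rightarrow> nat \<Rightarrow> ('g list \<Rightarrow> 'm::ab_group_add) \<Rightarrow> 'g list \<Rightarrow> 'm" where
  "bar_diff G \<rho> n f = (\<lambda>xs. if xs \<in> tuples G (Suc n)
     then \<rho> (hd xs) (f (tl xs)) + (\<Sum>i<n. signed (Suc i) (f (merge_at G i xs)))
            + signed (Suc n) (f (butlast xs))
     else 0)"

definition trivial_action :: "'g \<Rightarrow> 'm \<Rightarrow> 'm" where
  "trivial_action g x = x"


subsection \<open>The three cohomology theories and the maps between them\<close>

text \<open>The coefficients \<open>\<int>\<close> and \<open>\<real>\<close> are the instances \<open>int\<close> and \<open>real\<close> of the type variable \<open>'a\<close>.\<close>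

definition ordinary_cohomology ::
    "('g, 'b) monoid_scheme \<Rightarrow> nat \<Rightarrow> ('g list \<Rightarrow> 'a::linordered_idom) set monoid" where
  "ordinary_cohomology G = cohomology (cochains G UNIV) (bar_diff G trivial_action)"

definition bounded_cochains ::
    "('g, 'b) monoid_scheme \<Rightarrow> nat \<Rightarrow> ('g list \<Rightarrow> 'a::linordered_idom) set" where
  "bounded_cochains G n = {f \<in> cochains G UNIV n. \<exists>K. \<forall>xs \<in> tuples G n. \<bar>f xs\<bar> \<le> K}"

definition bounded_cohomology ::
    "('g, 'b) monoid_scheme \<Rightarrow> nat \<Rightarrow> ('g list \<Rightarrow> 'a::linordered_idom) set monoid" where
  "bounded_cohomology G = cohomology (bounded_cochains G) (bar_diff G trivial_action)"

definition comparison_map ::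
    "('g, 'b) monoid_scheme \<Rightarrow> nat \<Rightarrow> ('g list \<Rightarrow> 'a::linordered_idom) set \<Rightarrow> ('g list \<Rightarrow> 'a) set" where
  "comparison_map G = induced_map (\<lambda>f. f) (cochains G UNIV) (bar_diff G trivial_action)"

text \<open>As for cochains, a function on the group is extended by 0 outside the carrier.\<close>

definition linfty :: "('g, 'b) monoid_scheme \<Rightarrow> ('g \<Rightarrow> 'a::linordered_idom) set" where
  "linfty G = {\<phi>. (\<exists>K. \<forall>h \<in> carrier G. \<bar>\<phi> h\<bar> \<le> K) \<and> (\<forall>h. h \<notin> carrier G \<longrightarrow> \<phi> h = 0)}"

definition left_translation ::
    "('g, 'b) monoid_scheme \<Rightarrow> 'g \<Rightarrow> ('g \<Rightarrow> 'a::linordered_idom) \<Rightarrow> 'g \<Rightarrow> 'a" where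
  "left_translation G g \<phi> = (\<lambda>h. if h \<in> carrier G then \<phi> (inv\<^bsub>G\<^esub> g \<otimes>\<^bsub>G\<^esub> h) else 0)"

definition linfty_cohomology ::
    "('g, 'b) monoid_scheme \<Rightarrow> nat \<Rightarrow> ('g list \<Rightarrow> 'g \<Rightarrow> 'a::linordered_idom) set monoid" where
  "linfty_cohomology G = cohomology (cochains G (linfty G)) (bar_diff G (left_translation G))"

definition const_fun :: "('g, 'b) monoid_scheme \<Rightarrow> 'a::linordered_idom \<Rightarrow> 'g \<Rightarrow> 'a" where
  "const_fun G a = (\<lambda>h. if h \<in> carrier G then a else 0)"

definition iota_map ::
    "('g, 'b) monoid_scheme \<Rightarrow> nat \<Rightarrow> ('g list \<Rightarrow> 'a::linordered_idom) set
      \<Rightarrow> ('g list \<Rightarrow> 'g \<Rightarrow> 'a) set" where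
  "iota_map G = induced_map (\<lambda>f xs. const_fun G (f xs))
     (cochains G (linfty G)) (bar_diff G (left_translation G))"

end

theory Submission
  imports Defs "HOL-Library.Countable_Set"
begin

text \<open>A class in \<open>H\<^sup>2(G)\<close> dies in \<open>H\<^sup>2\<^sub>(\<^sub>\<infinity>\<^sub>)(G)\<close> as soon as it has a cocycle \<open>w\<close> for which every
  \<open>w(g, \<cdot>)\<close> is bounded. Such cocycles come from groups \<open>E\<close> of permutations of \<open>X \<times> \<int>\<close> that commute
  with the shift \<open>z\<close> of the second factor and displace the second coordinate boundedly: take the
  central extension \<open>E \<rightarrow> G = E/(E \<inter> \<langle>z\<rangle>)\<close>, with \<open>\<Phi>(e)\<close> the second coordinate of \<open>e(x\<^sub>0, 0)\<close>.

  There are permutations \<open>s\<close>, \<open>t\<close> of \<open>X = \<nat>\<close> and bounded \<open>f\<close>, \<open>g\<close> with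
  \<open>(f - f \<circ> s\<^sup>-\<^sup>1) + (g - g \<circ> t\<^sup>-\<^sup>1) = 1\<close>; in particular no mean is invariant under \<open>s\<close> and \<open>t\<close>.
  Let \<open>f\<close>, \<open>g\<close> act on \<open>X \<times> \<int>\<close> by translating the fibres, and let \<open>E\<close> be generated by
  \<open>f, g, s, t\<close>. Then \<open>z\<^sup>n = [f\<^sup>n, s] [g\<^sup>n, t]\<close> for all \<open>n\<close>. If the class were bounded, some
  function \<open>\<Phi> - \<psi>\<close> with \<open>\<psi>\<close> defined on \<open>G\<close> would be a quasimorphism of \<open>E\<close>, so it would be
  bounded on products of two commutators; but it grows like \<open>n\<close> on \<open>z\<^sup>n\<close>.\<close>

section \<open>The bar complex in degrees one to three\<close>

lemma tuples_Suc_0: "tuples G (Suc 0) = {[a] | a. a \<in> carrier G}"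
  by (auto simp: tuples_def length_Suc_conv)

lemma tuples_2: "tuples G 2 = {[a, b] | a b. a \<in> carrier G \<and> b \<in> carrier G}"
  by (auto simp: tuples_def numeral_2_eq_2 length_Suc_conv)

lemma tuples_3: "tuples G 3 = {[a, b, c] | a b c. a \<in> carrier G \<and> b \<in> carrier G \<and> c \<in> carrier G}"
  by (auto simp: tuples_def numeral_3_eq_3 length_Suc_conv)

lemma bar_diff_1:
  "bar_diff G \<rho> (Suc 0) f [a, b] = (if a \<in> carrier G \<and> b \<in> carrier G
     then \<rho> a (f [b]) - f [a \<otimes>\<^bsub>G\<^esub> b] + f [a] else 0)"
  by (auto simp: bar_diff_def tuples_def merge_at_def signed_def)

lemma bar_diff_1_outside: "xs \<notin> tuples G 2 \<Longrightarrow> bar_diff G \<rho> (Suc 0) f xs = 0"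
  by (simp add: bar_diff_def numeral_2_eq_2)

lemma signed_simps: "signed 0 x = x" "signed (Suc k) x = - signed k x"
  by (simp_all add: signed_def)

lemma bar_diff_2:
  "bar_diff G \<rho> 2 f [a, b, c] = (if a \<in> carrier G \<and> b \<in> carrier G \<and> c \<in> carrier G
     then \<rho> a (f [b, c]) - f [a \<otimes>\<^bsub>G\<^esub> b, c] + f [a, b \<otimes>\<^bsub>G\<^esub> c] - f [a, b] else 0)"
  by (auto simp: bar_diff_def tuples_def merge_at_def signed_simps numeral_2_eq_2)

lemma bar_diff_2_outside: "xs \<notin> tuples G 3 \<Longrightarrow> bar_diff G \<rho> 2 f xs = 0"
  by (simp add: bar_diff_def numeral_3_eq_3 numeral_2_eq_2)

lemma bar_diff_1_add:
  assumes "\<And>a x y. \<rho> a (x + y) = \<rho> a x + \<rho> a y"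
  shows "bar_diff G \<rho> (Suc 0) (f + g) = bar_diff G \<rho> (Suc 0) f + bar_diff G \<rho> (Suc 0) g"
proof
  fix xs
  show "bar_diff G \<rho> (Suc 0) (f + g) xs = (bar_diff G \<rho> (Suc 0) f + bar_diff G \<rho> (Suc 0) g) xs"
  proof (cases "xs \<in> tuples G 2")
    case True
    then show ?thesis
      by (auto simp: tuples_2 bar_diff_1 assms)
  qed (simp add: bar_diff_1_outside)
qed

lemma left_translation_add:
  "left_translation G a (x + y) = left_translation G a x + left_translation G a y"
  by (auto simp: left_translation_def fun_eq_iff)

lemma const_fun_add: "const_fun G (x + y) = const_fun G x + const_fun G y"
  by (auto simp: const_fun_def fun_eq_iff)

lemma const_fun_minus: "const_fun G (- x) = - const_fun G x"
  by (auto simp: const_fun_def fun_eq_iff)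

lemma (in group) left_translation_const_fun:
  "a \<in> carrier G \<Longrightarrow> left_translation G a (const_fun G x) = const_fun G x"
  by (auto simp: const_fun_def left_translation_def fun_eq_iff)

lemma const_fun_in_linfty: "const_fun G x \<in> linfty G"
  by (auto simp: const_fun_def linfty_def)

lemma linfty_add: "x \<in> linfty G \<Longrightarrow> y \<in> linfty G \<Longrightarrow> x + y \<in> linfty G"
proof -
  assume "x \<in> linfty G" "y \<in> linfty G"
  then obtain K L where "\<forall>h\<in>carrier G. \<bar>x h\<bar> \<le> K" "\<forall>h\<in>carrier G. \<bar>y h\<bar> \<le> L"
    and *: "\<forall>h. h \<notin> carrier G \<longrightarrow> x h = 0" "\<forall>h. h \<notin> carrier G \<longrightarrow> y h = 0"
    by (auto simp: linfty_def)
  then have "\<forall>h\<in>carrier G. \<bar>(x + y) h\<bar> \<le> K + L"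
    by (auto intro: order_trans[OF abs_triangle_ineq] add_mono)
  with * show ?thesis
    by (auto simp: linfty_def)
qed

lemma linfty_uminus: "x \<in> linfty G \<Longrightarrow> - x \<in> linfty G"
  by (auto simp: linfty_def)

lemma cochains_linfty_add:
  "f \<in> cochains G (linfty G) n \<Longrightarrow> g \<in> cochains G (linfty G) n \<Longrightarrow> f + g \<in> cochains G (linfty G) n"
  by (auto simp: cochains_def linfty_add)

lemma cochains_linfty_uminus:
  "f \<in> cochains G (linfty G) n \<Longrightarrow> - f \<in> cochains G (linfty G) n"
  by (auto simp: cochains_def linfty_uminus)

section \<open>Two-cocycles bounded in the second argument, and the failure of exactness\<close>

definition cochain2 :: "('g, 'b) monoid_scheme \<Rightarrow> ('g \<Rightarrow> 'g \<Rightarrow> 'm::zero) \<Rightarrow> 'g list \<Rightarrow> 'm" where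
  "cochain2 G w xs = (if xs \<in> tuples G 2 then w (xs ! 0) (xs ! 1) else 0)"

lemma cochain2_pair [simp]:
  "a \<in> carrier G \<Longrightarrow> b \<in> carrier G \<Longrightarrow> cochain2 G w [a, b] = w a b"
  by (simp add: cochain2_def tuples_2)

lemma (in group) cochain2_in_cocycles:
  fixes w :: "'a \<Rightarrow> 'a \<Rightarrow> 'm::linordered_idom"
  assumes "\<And>a b c. \<lbrakk>a \<in> carrier G; b \<in> carrier G; c \<in> carrier G\<rbrakk> \<Longrightarrow>
      w a b + w (a \<otimes> b) c = w b c + w a (b \<otimes> c)"
  shows "cochain2 G w \<in> cocycles (cochains G UNIV) (bar_diff G trivial_action) 2"
proof -
  have "bar_diff G trivial_action 2 (cochain2 G w) xs = 0" for xs
  proof (cases "xs \<in> tuples G 3")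
    case True
    then obtain a b c where "xs = [a, b, c]"
      and *: "a \<in> carrier G" "b \<in> carrier G" "c \<in> carrier G"
      by (auto simp: tuples_3)
    then show ?thesis
      using assms[OF *] by (simp add: bar_diff_2 trivial_action_def algebra_simps)
  qed (simp add: bar_diff_2_outside)
  then show ?thesis
    by (auto simp: cocycles_def cochains_def cochain2_def fun_eq_iff)
qed

text \<open>The primitive is \<open>\<phi>(a)(k) = w(a, a^-1 k)\<close>. It takes values in bounded
  functions precisely because each \<open>w(a, _)\<close> is bounded; no bound uniform in
  \<open>a\<close> is required, which is weaker than boundedness of \<open>w\<close>.\<close>

lemma (in group) const_cochain2_primitive:
  fixes w :: "'a \<Rightarrow> 'a \<Rightarrow> 'm::linordered_idom"
  assumes cocycle: "\<And>a b c. \<lbrakk>a \<in> carrier G; b \<in> carrier G; c \<in> carrier G\<rbrakk> \<Longrightarrow>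
      w a b + w (a \<otimes> b) c = w b c + w a (b \<otimes> c)"
    and bounded: "\<And>a. a \<in> carrier G \<Longrightarrow> \<exists>K. \<forall>b\<in>carrier G. \<bar>w a b\<bar> \<le> K"
  obtains \<phi> where "\<phi> \<in> cochains G (linfty G) (Suc 0)"
    "bar_diff G (left_translation G) (Suc 0) \<phi> = (\<lambda>xs. const_fun G (cochain2 G w xs))"
proof -
  define \<phi> where "\<phi> = (\<lambda>xs k. if xs \<in> tuples G (Suc 0) \<and> k \<in> carrier G
    then w (hd xs) (inv (hd xs) \<otimes> k) else 0)"
  have "\<exists>K. \<forall>k\<in>carrier G. \<bar>w a (inv a \<otimes> k)\<bar> \<le> K" if "a \<in> carrier G" for a
    using bounded[OF that] that by (meson inv_closed m_closed)
  then have "\<phi> \<in> cochains G (linfty G) (Suc 0)"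
    by (auto simp: cochains_def linfty_def \<phi>_def tuples_Suc_0 fun_eq_iff)
  moreover have "bar_diff G (left_translation G) (Suc 0) \<phi> xs k = const_fun G (cochain2 G w xs) k" for xs k
  proof (cases "xs \<in> tuples G 2 \<and> k \<in> carrier G")
    case True
    then obtain a b where *: "xs = [a, b]" "a \<in> carrier G" "b \<in> carrier G" "k \<in> carrier G"
      by (auto simp: tuples_2)
    \<comment> \<open>With \<open>m = (ab)^-1 k\<close>, the coboundary of \<open>\<phi>\<close> on
      \<open>[a, b]\<close> at \<open>k\<close> is \<open>w b m - w (ab) m + w a (bm)\<close>, which
      equals \<open>w a b\<close> by the cocycle identity for \<open>a, b, m\<close>.\<close>
    define m where "m = inv b \<otimes> (inv a \<otimes> k)"
    have m: "m \<in> carrier G" "inv (a \<otimes> b) \<otimes> k = m" "inv a \<otimes> k = b \<otimes> m"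
      using * by (simp_all add: m_def inv_mult_group m_assoc flip: m_assoc[of b])
    have "inv b \<otimes> (b \<otimes> m) = m"
      using *(3) m(1) by (simp flip: m_assoc)
    then show ?thesis
      using * m cocycle[of a b m]
      by (simp add: bar_diff_1 const_fun_def left_translation_def \<phi>_def tuples_Suc_0 m_def[symmetric])
  next
    case False
    then show ?thesis
      by (cases "xs \<in> tuples G 2") (auto simp: bar_diff_1_outside const_fun_def cochain2_def
         tuples_2 bar_diff_1 left_translation_def \<phi>_def)
  qed
  ultimately show thesis
    using that by blast
qed

lemma coboundaries_2: "coboundaries C d 2 = d (Suc 0) ` C (Suc 0)"
  by (simp add: coboundaries_def numeral_2_eq_2)

lemma carrier_cohomology:
  "carrier (cohomology C d n) = (\<lambda>z. (\<lambda>b. b + z) ` coboundaries C d n) ` cocycles C d n"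
  by (auto simp: cohomology_def carrier_FactGroup additive_group_def r_coset_def)

lemma induced_map_eq:
  "induced_map \<phi> D d n X = {b + \<phi> x | b x. b \<in> coboundaries D d n \<and> x \<in> X}"
  by (auto simp: induced_map_def set_mult_def additive_group_def)

lemma one_cohomology: "\<one>\<^bsub>cohomology C d n\<^esub> = coboundaries C d n"
  by (simp add: cohomology_def)

text \<open>Left translation fixes constant functions, so the embedding of the coefficients is
  equivariant and commutes with the differential.\<close>

lemma (in group) const_bar_diff_1:
  "(\<lambda>xs. const_fun G (bar_diff G trivial_action (Suc 0) \<psi> xs))
     = bar_diff G (left_translation G) (Suc 0) (\<lambda>xs. const_fun G (\<psi> xs))"
proof
  fix xs
  show "const_fun G (bar_diff G trivial_action (Suc 0) \<psi> xs)
    = bar_diff G (left_translation G) (Suc 0) (\<lambda>xs. const_fun G (\<psi> xs)) xs"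
  proof (cases "xs \<in> tuples G 2")
    case True
    then show ?thesis
      by (auto simp: tuples_2 bar_diff_1 trivial_action_def left_translation_const_fun
          const_fun_add const_fun_minus diff_conv_add_uminus simp del: add_uminus_conv_diff)
  qed (auto simp: bar_diff_1_outside const_fun_def fun_eq_iff)
qed

text \<open>By \<open>bounded\<close>, the cocycle \<open>w\<close> acquires a primitive in bounded
  functions, so \<open>iota_map\<close> kills its class. A preimage of the class under
  \<open>comparison_map\<close> would yield a bounded cocycle differing from \<open>w\<close> by the
  coboundary of some \<open>\<psi>\<close>, which \<open>unbounded\<close> excludes.\<close>

lemma (in group) not_exact_at_if_weakly_bounded_unbounded:
  fixes w :: "'a \<Rightarrow> 'a \<Rightarrow> 'm::linordered_idom"
  assumes cocycle: "\<And>a b c. \<lbrakk>a \<in> carrier G; b \<in> carrier G; c \<in> carrier G\<rbrakk> \<Longrightarrow>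
      w a b + w (a \<otimes> b) c = w b c + w a (b \<otimes> c)"
    and bounded: "\<And>a. a \<in> carrier G \<Longrightarrow> \<exists>K. \<forall>b\<in>carrier G. \<bar>w a b\<bar> \<le> K"
    and unbounded: "\<And>\<psi> K. \<exists>a\<in>carrier G. \<exists>b\<in>carrier G. K < \<bar>\<psi> b - \<psi> (a \<otimes> b) + \<psi> a + w a b\<bar>"
  shows "\<not> exact_at
        (bounded_cohomology G 2 :: ('a list \<Rightarrow> 'm) set monoid) (comparison_map G 2)
        (ordinary_cohomology G 2 :: ('a list \<Rightarrow> 'm) set monoid) (iota_map G 2)
        (linfty_cohomology G 2 :: ('a list \<Rightarrow> 'a \<Rightarrow> 'm) set monoid)"
proof -
  let ?d = "bar_diff G (trivial_action :: 'a \<Rightarrow> 'm \<Rightarrow> 'm)"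
  let ?d' = "bar_diff G (left_translation G :: 'a \<Rightarrow> ('a \<Rightarrow> 'm) \<Rightarrow> _)"
  let ?C' = "cochains G (linfty G :: ('a \<Rightarrow> 'm) set) (Suc 0)"
  define \<Omega> where "\<Omega> = cochain2 G w"
  define X where "X = {?d (Suc 0) \<psi> + \<Omega> | \<psi>. \<psi> \<in> cochains G UNIV (Suc 0)}"
  have X: "X \<in> carrier (ordinary_cohomology G 2)"
    using cochain2_in_cocycles[of w, OF cocycle]
    unfolding X_def \<Omega>_def ordinary_cohomology_def carrier_cohomology coboundaries_2 image_image
    by (intro image_eqI) auto
  obtain \<phi> where \<phi>: "\<phi> \<in> ?C'" "?d' (Suc 0) \<phi> = (\<lambda>xs. const_fun G (\<Omega> xs))"
    unfolding \<Omega>_def using const_cochain2_primitive[of w, OF cocycle bounded] by blast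
  have d'_add: "?d' (Suc 0) (f + g) = ?d' (Suc 0) f + ?d' (Suc 0) g" for f g
    by (rule bar_diff_1_add) (rule left_translation_add)
  have const_X: "(\<lambda>xs. const_fun G ((?d (Suc 0) \<psi> + \<Omega>) xs))
      = ?d' (Suc 0) ((\<lambda>xs. const_fun G (\<psi> xs)) + \<phi>)" for \<psi>
    unfolding d'_add \<phi>(2) const_bar_diff_1[symmetric] by (simp add: fun_eq_iff const_fun_add)
  have "iota_map G 2 X = ?d' (Suc 0) ` ?C'"
  proof (intro equalityI subsetI)
    fix y assume "y \<in> iota_map G 2 X"
    then obtain \<theta> \<psi> where "\<theta> \<in> ?C'" "\<psi> \<in> cochains G UNIV (Suc 0)"
      "y = ?d' (Suc 0) \<theta> + ?d' (Suc 0) ((\<lambda>xs. const_fun G (\<psi> xs)) + \<phi>)"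
      by (auto simp: iota_map_def induced_map_eq coboundaries_2 X_def
          simp flip: const_X)
    moreover have "(\<lambda>xs. const_fun G (\<psi> xs)) \<in> ?C'"
      using \<open>\<psi> \<in> _\<close> by (auto simp: cochains_def const_fun_in_linfty) (auto simp: const_fun_def)
    ultimately show "y \<in> ?d' (Suc 0) ` ?C'"
      using \<phi>(1) by (auto simp flip: d'_add intro!: imageI cochains_linfty_add)
  next
    fix y assume "y \<in> ?d' (Suc 0) ` ?C'"
    then obtain \<theta> where \<theta>: "\<theta> \<in> ?C'" "y = ?d' (Suc 0) \<theta>" by auto
    \<comment> \<open>Every coboundary must occur in the image class, not only some: the
      representative \<open>\<Omega>\<close> itself (\<open>\<psi> = 0\<close>) contributes the
      coboundary of \<open>\<phi>\<close>, and \<open>\<theta> - \<phi>\<close> makes up the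
      difference.\<close>
    have "y = ?d' (Suc 0) (\<theta> + - \<phi>) + ?d' (Suc 0) ((\<lambda>xs. const_fun G ((0 :: 'a list \<Rightarrow> 'm) xs)) + \<phi>)"
      unfolding \<theta>(2) d'_add[symmetric]
      by (rule arg_cong[of _ _ "?d' (Suc 0)"]) (auto simp: const_fun_def fun_eq_iff)
    moreover have "\<theta> + - \<phi> \<in> ?C'"
      by (intro cochains_linfty_add cochains_linfty_uminus \<theta> \<phi>)
    moreover have "(0 :: 'a list \<Rightarrow> 'm) \<in> cochains G UNIV (Suc 0)"
      by (auto simp: cochains_def)
    ultimately show "y \<in> iota_map G 2 X"
      unfolding iota_map_def induced_map_eq coboundaries_2 X_def const_X[symmetric] by blast
  qed
  then have kernel: "X \<in> kernel (ordinary_cohomology G 2)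
      (linfty_cohomology G 2 :: ('a list \<Rightarrow> 'a \<Rightarrow> 'm) set monoid) (iota_map G 2)"
    using X by (simp add: kernel_def linfty_cohomology_def one_cohomology coboundaries_2)
  have "X \<notin> comparison_map G 2 ` carrier (bounded_cohomology G 2)"
  proof
    assume "X \<in> comparison_map G 2 ` carrier (bounded_cohomology G 2)"
    then obtain \<beta> where \<beta>: "\<beta> \<in> bounded_cochains G 2"
      and X': "X = comparison_map G 2 ((\<lambda>b. b + \<beta>) ` ?d (Suc 0) ` bounded_cochains G (Suc 0))"
      by (auto simp: bounded_cohomology_def carrier_cohomology coboundaries_2 cocycles_def)
    have d0: "?d (Suc 0) 0 = 0"
      using bar_diff_1_add[of trivial_action G 0 0] by (simp add: trivial_action_def)
    have 0: "0 \<in> bounded_cochains G (Suc 0)" "0 \<in> cochains G UNIV (Suc 0)"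
      by (auto simp: bounded_cochains_def cochains_def)
    have "0 \<in> coboundaries (cochains G UNIV) ?d 2"
      unfolding coboundaries_2 using d0 0(2) by (metis imageI)
    moreover have "\<beta> \<in> (\<lambda>b. b + \<beta>) ` ?d (Suc 0) ` bounded_cochains G (Suc 0)"
      using d0 0(1) by (auto simp: image_image intro!: image_eqI[of _ _ 0])
    \<comment> \<open>Taking the zero coboundary in both complexes shows that the bounded
      representative lies in the class.\<close>
    ultimately have "\<beta> \<in> X"
      unfolding X' comparison_map_def induced_map_eq by force
    then obtain \<psi> where "\<beta> = ?d (Suc 0) \<psi> + \<Omega>" by (auto simp: X_def)
    moreover from \<beta> obtain K where "\<And>xs. xs \<in> tuples G 2 \<Longrightarrow> \<bar>\<beta> xs\<bar> \<le> K"
      by (auto simp: bounded_cochains_def)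
    ultimately have "\<bar>\<psi> [b] - \<psi> [a \<otimes> b] + \<psi> [a] + w a b\<bar> \<le> K"
      if "a \<in> carrier G" "b \<in> carrier G" for a b
      using that by (force simp: tuples_2 bar_diff_1 trivial_action_def \<Omega>_def)
    then show False
      using unbounded[of K "\<lambda>a. \<psi> [a]"] by (force simp: not_less[symmetric])
  qed
  with kernel show ?thesis
    unfolding exact_at_def by blast
qed

section \<open>Quasimorphisms on commutators, and cocycles of central extensions\<close>

definition commutator :: "('e, 'b) monoid_scheme \<Rightarrow> 'e \<Rightarrow> 'e \<Rightarrow> 'e" where
  "commutator E x y = x \<otimes>\<^bsub>E\<^esub> y \<otimes>\<^bsub>E\<^esub> inv\<^bsub>E\<^esub> x \<otimes>\<^bsub>E\<^esub> inv\<^bsub>E\<^esub> y"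

lemma (in group) commutator_closed:
  "x \<in> carrier G \<Longrightarrow> y \<in> carrier G \<Longrightarrow> commutator G x y \<in> carrier G"
  by (simp add: commutator_def)

text \<open>The three products in the commutator cost \<open>3 * D\<close>. Each of the sums
  \<open>q x + q (x^-1)\<close> and \<open>q y + q (y^-1)\<close> is within \<open>2 * D\<close> of
  zero: one \<open>D\<close> for the product and one for the value at the identity.\<close>

lemma quasimorphism_commutator:
  fixes q :: "'a \<Rightarrow> 'm::linordered_idom"
  assumes "group E" and D: "\<And>x y. \<lbrakk>x \<in> carrier E; y \<in> carrier E\<rbrakk> \<Longrightarrow> \<bar>q (x \<otimes>\<^bsub>E\<^esub> y) - q x - q y\<bar> \<le> D"
    and x: "x \<in> carrier E" and y: "y \<in> carrier E"
  shows "\<bar>q (commutator E x y)\<bar> \<le> 7 * D"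
proof -
  interpret group E by fact
  have upper: "q (x \<otimes>\<^bsub>E\<^esub> y) \<le> q x + q y + D" and lower: "q x + q y - D \<le> q (x \<otimes>\<^bsub>E\<^esub> y)"
    if "x \<in> carrier E" "y \<in> carrier E" for x y
    using D[OF that] unfolding abs_le_iff by linarith+
  have one: "q \<one>\<^bsub>E\<^esub> \<le> D" "- D \<le> q \<one>\<^bsub>E\<^esub>"
    using D[of "\<one>\<^bsub>E\<^esub>" "\<one>\<^bsub>E\<^esub>"] unfolding abs_le_iff by simp_all
  have inv_upper: "q z + q (inv\<^bsub>E\<^esub> z) \<le> 2 * D" and inv_lower: "- (2 * D) \<le> q z + q (inv\<^bsub>E\<^esub> z)"
    if "z \<in> carrier E" for z
    using upper[of z "inv\<^bsub>E\<^esub> z"] lower[of z "inv\<^bsub>E\<^esub> z"] one that by simp_all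
  have closed: "x \<otimes>\<^bsub>E\<^esub> y \<in> carrier E" "inv\<^bsub>E\<^esub> x \<in> carrier E" "inv\<^bsub>E\<^esub> y \<in> carrier E"
    "x \<otimes>\<^bsub>E\<^esub> y \<otimes>\<^bsub>E\<^esub> inv\<^bsub>E\<^esub> x \<in> carrier E"
    using x y by auto
  show ?thesis
    using upper[OF x y] upper[OF closed(1,2)] upper[OF closed(4,3)]
      lower[OF x y] lower[OF closed(1,2)] lower[OF closed(4,3)]
      inv_upper[OF x] inv_upper[OF y] inv_lower[OF x] inv_lower[OF y]
    unfolding commutator_def abs_le_iff by linarith
qed

text \<open>\<open>E\<close> plays the role of the central extension with cocycle \<open>w\<close>, and \<open>\<Phi>\<close> is the fibre
  coordinate.\<close>

lemma not_exact_at_if_central_extension: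
  fixes \<Phi> :: "'e \<Rightarrow> int" and w :: "'g \<Rightarrow> 'g \<Rightarrow> int"
  assumes "group_hom E G p" and onto: "p ` carrier E = carrier G"
    and \<Phi>_mult: "\<And>x y. \<lbrakk>x \<in> carrier E; y \<in> carrier E\<rbrakk> \<Longrightarrow> \<Phi> (x \<otimes>\<^bsub>E\<^esub> y) = \<Phi> x + \<Phi> y + w (p x) (p y)"
    and displacement: "\<And>x. x \<in> carrier E \<Longrightarrow> \<exists>K. \<forall>y\<in>carrier E. \<bar>\<Phi> (x \<otimes>\<^bsub>E\<^esub> y) - \<Phi> y\<bar> \<le> K"
    and commutators: "\<And>n::nat. \<exists>a\<in>carrier E. \<exists>b\<in>carrier E. \<exists>c\<in>carrier E. \<exists>d\<in>carrier E.
      p (commutator E a b \<otimes>\<^bsub>E\<^esub> commutator E c d) = \<one>\<^bsub>G\<^esub> \<and>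
      \<Phi> (commutator E a b \<otimes>\<^bsub>E\<^esub> commutator E c d) = int n"
    and archimedean: "\<And>K::'m::linordered_idom. \<exists>n. K < of_nat n"
  shows "\<not> exact_at
        (bounded_cohomology G 2 :: ('g list \<Rightarrow> 'm) set monoid) (comparison_map G 2)
        (ordinary_cohomology G 2 :: ('g list \<Rightarrow> 'm) set monoid) (iota_map G 2)
        (linfty_cohomology G 2 :: ('g list \<Rightarrow> 'g \<Rightarrow> 'm) set monoid)"
proof -
  interpret group_hom E G p by fact
  have lift: thesis
    if "a \<in> carrier G" "\<And>x. \<lbrakk>x \<in> carrier E; a = p x\<rbrakk> \<Longrightarrow> thesis" for a thesis
    using that by (auto simp flip: onto)
  define w' :: "'g \<Rightarrow> 'g \<Rightarrow> 'm" where "w' = (\<lambda>a b. of_int (w a b))"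
  show ?thesis
  proof (rule H.not_exact_at_if_weakly_bounded_unbounded[of w'])
    fix a b c assume "a \<in> carrier G" "b \<in> carrier G" "c \<in> carrier G"
    obtain x where x: "x \<in> carrier E" "a = p x"
      by (rule lift[OF \<open>a \<in> carrier G\<close>])
    obtain y where y: "y \<in> carrier E" "b = p y"
      by (rule lift[OF \<open>b \<in> carrier G\<close>])
    obtain z where z: "z \<in> carrier E" "c = p z"
      by (rule lift[OF \<open>c \<in> carrier G\<close>])
    \<comment> \<open>Expanding \<open>\<Phi>\<close> on both bracketings of \<open>xyz\<close>
      gives the cocycle identity for \<open>w\<close>.\<close>
    have "w a b + w (a \<otimes>\<^bsub>G\<^esub> b) c = w b c + w a (b \<otimes>\<^bsub>G\<^esub> c)"
      using x y z \<Phi>_mult[of x y] \<Phi>_mult[of "x \<otimes>\<^bsub>E\<^esub> y" z] \<Phi>_mult[of y z] \<Phi>_mult[of x "y \<otimes>\<^bsub>E\<^esub> z"]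
      by (simp add: G.m_assoc)
    then show "w' a b + w' (a \<otimes>\<^bsub>G\<^esub> b) c = w' b c + w' a (b \<otimes>\<^bsub>G\<^esub> c)"
      by (simp add: w'_def flip: of_int_add)
  next
    fix a assume "a \<in> carrier G"
    then obtain x where x: "x \<in> carrier E" "a = p x"
      by (rule lift)
    obtain K where K: "\<forall>y\<in>carrier E. \<bar>\<Phi> (x \<otimes>\<^bsub>E\<^esub> y) - \<Phi> y\<bar> \<le> K"
      using displacement x by blast
    \<comment> \<open>Here \<open>w a b = (\<Phi>(xy) - \<Phi> y) - \<Phi> x\<close>, and the
      bracket is the displacement by \<open>x\<close>.\<close>
    have "\<bar>w a b\<bar> \<le> K + \<bar>\<Phi> x\<bar>" if "b \<in> carrier G" for b
    proof -
      from that obtain y where "y \<in> carrier E" "b = p y"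
        by (rule lift)
      then show ?thesis
        using K x \<Phi>_mult[of x y] by force
    qed
    then have "\<forall>b\<in>carrier G. \<bar>w' a b\<bar> \<le> of_int (K + \<bar>\<Phi> x\<bar>)"
      unfolding w'_def by (metis of_int_abs of_int_le_iff)
    then show "\<exists>K. \<forall>b\<in>carrier G. \<bar>w' a b\<bar> \<le> K" ..
  next
    fix \<psi> :: "'g \<Rightarrow> 'm" and K :: 'm
    show "\<exists>a\<in>carrier G. \<exists>b\<in>carrier G. K < \<bar>\<psi> b - \<psi> (a \<otimes>\<^bsub>G\<^esub> b) + \<psi> a + w' a b\<bar>"
    proof (rule ccontr)
      assume "\<not> ?thesis"
      then have K: "\<bar>\<psi> b - \<psi> (a \<otimes>\<^bsub>G\<^esub> b) + \<psi> a + w' a b\<bar> \<le> K"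
        if "a \<in> carrier G" "b \<in> carrier G" for a b
        using that by (meson not_less)
      \<comment> \<open>The defect of \<open>q\<close> is \<open>w'\<close> plus the coboundary of
        \<open>\<psi>\<close>, so the assumed bound \<open>K\<close> makes \<open>q\<close> a
        quasimorphism.\<close>
      define q where "q x = of_int (\<Phi> x) - \<psi> (p x)" for x
      have q: "\<bar>q (x \<otimes>\<^bsub>E\<^esub> y) - q x - q y\<bar> \<le> K" if "x \<in> carrier E" "y \<in> carrier E" for x y
        using K[of "p x" "p y"] that by (simp add: q_def \<Phi>_mult w'_def algebra_simps)
      \<comment> \<open>The constant is \<open>15 = 7 + 7 + 1\<close>: two commutators and the
        product joining them. The element \<open>u\<close> below lies over the identity, hence
        \<open>q u = n - \<psi>(1)\<close>.\<close>
      obtain n where n: "15 * K + \<psi> \<one>\<^bsub>G\<^esub> < of_nat n"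
        using archimedean by blast
      obtain a b c d where abcd: "a \<in> carrier E" "b \<in> carrier E" "c \<in> carrier E" "d \<in> carrier E"
        and abcd': "p (commutator E a b \<otimes>\<^bsub>E\<^esub> commutator E c d) = \<one>\<^bsub>G\<^esub>"
          "\<Phi> (commutator E a b \<otimes>\<^bsub>E\<^esub> commutator E c d) = int n"
        using commutators[of n] by (elim bexE conjE)
      define v where "v = commutator E a b"
      define v' where "v' = commutator E c d"
      define u where "u = v \<otimes>\<^bsub>E\<^esub> v'"
      have u: "p u = \<one>\<^bsub>G\<^esub>" "\<Phi> u = int n"
        using abcd' by (simp_all add: u_def v_def v'_def)
      have "v \<in> carrier E" "v' \<in> carrier E"
        unfolding v_def v'_def using abcd by (auto intro: G.commutator_closed)
      then have "\<bar>q u - q v - q v'\<bar> \<le> K"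
        using q by (simp add: u_def)
      moreover have "\<bar>q v\<bar> \<le> 7 * K" "\<bar>q v'\<bar> \<le> 7 * K"
        unfolding v_def v'_def
        by (rule quasimorphism_commutator[OF G.group_axioms q]; use abcd in simp)+
      ultimately have "q u \<le> 15 * K"
        unfolding abs_le_iff by linarith
      then show False
        using n u by (simp add: q_def)
    qed
  qed
qed

section \<open>Permutations commuting with the shifts\<close>

definition shift :: "int \<Rightarrow> 'x \<times> int \<Rightarrow> 'x \<times> int" where
  "shift k = (\<lambda>(x, n). (x, n + k))"

text \<open>Commuting with \<open>shift\<close> makes the shifts central. The displacement bound is
  uniform over all points, so it bounds the change of the fibre coordinate under left multiplication
  by \<open>u\<close> independently of the other factor.\<close>

definition equivariant_group :: "('x \<times> int \<Rightarrow> 'x \<times> int) monoid" where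
  "equivariant_group = \<lparr>carrier = {u. bij u \<and> (\<forall>k. u \<circ> shift k = shift k \<circ> u)
      \<and> (\<exists>K. \<forall>z. \<bar>snd (u z) - snd z\<bar> \<le> K)},
    monoid.mult = (\<circ>), one = id\<rparr>"

lemma equivariant_group_simps [simp]:
  "x \<otimes>\<^bsub>equivariant_group\<^esub> y = x \<circ> y" "\<one>\<^bsub>equivariant_group\<^esub> = id"
  by (simp_all add: equivariant_group_def)

lemma comp_in_equivariant_group:
  assumes "u \<in> carrier equivariant_group" "v \<in> carrier equivariant_group"
  shows "u \<circ> v \<in> carrier equivariant_group"
proof -
  obtain K L where KL: "\<forall>z. \<bar>snd (u z) - snd z\<bar> \<le> K" "\<forall>z. \<bar>snd (v z) - snd z\<bar> \<le> L"
    using assms by (auto simp: equivariant_group_def simp del: split_paired_All)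
  have "\<bar>snd ((u \<circ> v) z) - snd z\<bar> \<le> K + L" for z
    using spec[OF KL(1), of "v z"] spec[OF KL(2), of z] by (simp add: abs_le_iff)
  then have "\<exists>K. \<forall>z. \<bar>snd ((u \<circ> v) z) - snd z\<bar> \<le> K"
    by blast
  moreover have "u \<circ> v \<circ> shift k = shift k \<circ> (u \<circ> v)" for k
    using assms by (auto simp: equivariant_group_def fun_eq_iff simp del: split_paired_All)
  moreover have "bij (u \<circ> v)"
    using assms by (auto simp: equivariant_group_def bij_comp)
  ultimately show ?thesis
    unfolding equivariant_group_def by (auto simp del: split_paired_All)
qed

lemma inv_in_equivariant_group:
  assumes "u \<in> carrier equivariant_group"
  shows "Hilbert_Choice.inv u \<in> carrier equivariant_group"
proof -
  have u: "bij u" "\<And>k z. u (shift k z) = shift k (u z)"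
    using assms by (auto simp: equivariant_group_def fun_eq_iff)
  obtain K where K: "\<forall>z. \<bar>snd (u z) - snd z\<bar> \<le> K"
    using assms by (auto simp: equivariant_group_def simp del: split_paired_All)
  \<comment> \<open>The displacement of the inverse at \<open>z\<close> is, up to sign, that of
    \<open>u\<close> at the preimage of \<open>z\<close>.\<close>
  have "\<bar>snd (Hilbert_Choice.inv u z) - snd z\<bar> \<le> K" for z
    using spec[OF K, of "Hilbert_Choice.inv u z"] u(1)
    by (simp add: bij_is_surj surj_f_inv_f abs_minus_commute)
  then have "\<exists>K. \<forall>z. \<bar>snd (Hilbert_Choice.inv u z) - snd z\<bar> \<le> K"
    by blast
  moreover have "Hilbert_Choice.inv u (shift k z) = shift k (Hilbert_Choice.inv u z)" for k z
  proof -
    have "u (shift k (Hilbert_Choice.inv u z)) = shift k z"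
      using u by (simp add: bij_is_surj surj_f_inv_f)
    then show ?thesis
      using u(1) by (intro inv_f_eq bij_is_inj)
  qed
  then have "Hilbert_Choice.inv u \<circ> shift k = shift k \<circ> Hilbert_Choice.inv u" for k
    by (simp add: fun_eq_iff del: split_paired_All)
  ultimately show ?thesis
    using u(1) unfolding equivariant_group_def
    by (auto simp: bij_imp_bij_inv simp del: split_paired_All)
qed

lemma group_equivariant_group: "group equivariant_group"
proof (rule groupI)
  fix u assume u: "u \<in> carrier equivariant_group"
  show "\<exists>v\<in>carrier equivariant_group. v \<otimes>\<^bsub>equivariant_group\<^esub> u = \<one>\<^bsub>equivariant_group\<^esub>"
    using inv_in_equivariant_group[OF u] u
    by (intro bexI[of _ "Hilbert_Choice.inv u"]) (auto simp: equivariant_group_def bij_is_inj)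
qed (auto simp: comp_in_equivariant_group o_assoc, auto simp: equivariant_group_def intro!: exI[of _ 0])

lemma m_inv_equivariant_group:
  assumes "u \<in> carrier equivariant_group"
  shows "inv\<^bsub>equivariant_group\<^esub> u = Hilbert_Choice.inv u"
  using assms
  by (intro group.inv_equality group_equivariant_group)
    (auto simp: inv_in_equivariant_group, auto simp: equivariant_group_def bij_is_inj)

definition fibre_map :: "('x \<Rightarrow> int) \<Rightarrow> 'x \<times> int \<Rightarrow> 'x \<times> int" where
  "fibre_map f = (\<lambda>(x, n). (x, n + f x))"

definition base_map :: "('x \<Rightarrow> 'x) \<Rightarrow> 'x \<times> int \<Rightarrow> 'x \<times> int" where
  "base_map s = (\<lambda>(x, n). (s x, n))"

lemma inv_fibre_map: "Hilbert_Choice.inv (fibre_map f) = fibre_map (\<lambda>x. - f x)"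
  by (rule inv_equality) (auto simp: fibre_map_def)

lemma inv_base_map: "bij s \<Longrightarrow> Hilbert_Choice.inv (base_map s) = base_map (Hilbert_Choice.inv s)"
  by (rule inv_equality) (auto simp: base_map_def bij_is_inj bij_is_surj surj_f_inv_f)

lemma fibre_map_in_equivariant_group:
  assumes "\<And>x. \<bar>f x\<bar> \<le> K"
  shows "fibre_map f \<in> carrier equivariant_group"
proof -
  have "bij (fibre_map f)"
    by (rule o_bij[of "fibre_map (\<lambda>x. - f x)"]) (auto simp: fibre_map_def)
  then show ?thesis
    using assms by (auto simp: equivariant_group_def fibre_map_def shift_def fun_eq_iff)
qed

lemma base_map_in_equivariant_group:
  assumes "bij s"
  shows "base_map s \<in> carrier equivariant_group"
proof -
  have "bij (base_map s)"
    by (rule o_bij[of "base_map (Hilbert_Choice.inv s)"])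
      (use assms in \<open>auto simp: base_map_def bij_is_inj bij_is_surj surj_f_inv_f\<close>)
  then show ?thesis
    by (auto simp: equivariant_group_def base_map_def shift_def fun_eq_iff intro!: exI[of _ 0])
qed

text \<open>Conjugating a fibre translation by \<open>base_map s\<close> precomposes its function
  with the inverse of \<open>s\<close>; the two fibre translations then add.\<close>

lemma commutator_fibre_base:
  assumes "bij s"
  shows "fibre_map f \<circ> base_map s \<circ> Hilbert_Choice.inv (fibre_map f) \<circ> Hilbert_Choice.inv (base_map s)
    = fibre_map (\<lambda>x. f x - f (Hilbert_Choice.inv s x))"
  using assms
  by (auto simp: inv_fibre_map inv_base_map fun_eq_iff)
    (auto simp: fibre_map_def base_map_def bij_is_surj surj_f_inv_f)

section \<open>A paradoxical decomposition of the natural numbers\<close>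

text \<open>Any two infinite sets of naturals are in bijection, so bijections from
  \<open>A \<union> B\<close> to \<open>A\<close> and from \<open>C\<close> to
  \<open>B \<union> C\<close> can be glued. The set \<open>C\<close> provides the room to absorb
  \<open>B\<close> in the complement.\<close>

lemma ex_shrinking_bij:
  fixes A B C :: "nat set"
  assumes "infinite A" "infinite C" "A \<union> B \<union> C = UNIV"
    "A \<inter> B = {}" "A \<inter> C = {}" "B \<inter> C = {}"
  obtains s where "bij s" "\<And>x. s x \<in> A \<longleftrightarrow> x \<in> A \<union> B"
proof -
  have bij: "\<exists>g. bij_betw g S T" if "infinite S" "infinite T" for S T :: "nat set"
    using that by (meson bij_betw_inv bij_betw_trans countableE_infinite countableI_type)
  obtain g where g: "bij_betw g (A \<union> B) A"
    using bij[of "A \<union> B" A] assms(1) by auto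
  obtain h where h: "bij_betw h C (B \<union> C)"
    using bij[of C "B \<union> C"] assms(2) by auto
  define s where "s x = (if x \<in> A \<union> B then g x else h x)" for x
  have "bij_betw (\<lambda>x. if x \<in> A \<union> B then g x else h x) ((A \<union> B) \<union> C) (A \<union> (B \<union> C))"
    by (rule bij_betw_disjoint_Un[OF g h]) (use assms in auto)
  then have "bij s"
    using assms(3) by (simp add: s_def[abs_def] Un_assoc)
  moreover have "s x \<in> A \<longleftrightarrow> x \<in> A \<union> B" for x
  proof (cases "x \<in> A \<union> B")
    case True
    then show ?thesis
      using bij_betwE[OF g] by (simp add: s_def)
  next
    case False
    then have "x \<in> C"
      using assms(3) by auto
    then show ?thesis
      using False bij_betwE[OF h] assms by (auto simp: s_def)
  qed
  ultimately show thesis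
    using that by blast
qed

text \<open>If \<open>s\<close> maps \<open>A \<union> B\<close> onto \<open>A\<close>, then \<open>1\<^sub>B = 1\<^sub>A\<^sub>\<union>\<^sub>B - 1\<^sub>A\<^sub>\<union>\<^sub>B \<circ> s\<^sup>-\<^sup>1\<close>.\<close>

lemma ex_indicator_difference:
  fixes A B C :: "nat set"
  assumes "infinite A" "infinite C" "A \<union> B \<union> C = UNIV"
    "A \<inter> B = {}" "A \<inter> C = {}" "B \<inter> C = {}"
  obtains s and f :: "nat \<Rightarrow> int"
  where "bij s" "\<And>x. \<bar>f x\<bar> \<le> 1" "\<And>x. f x - f (Hilbert_Choice.inv s x) = of_bool (x \<in> B)"
proof -
  obtain s where s: "bij s" "\<And>x. s x \<in> A \<longleftrightarrow> x \<in> A \<union> B"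
    using ex_shrinking_bij[OF assms] by blast
  have inv: "Hilbert_Choice.inv s x \<in> A \<union> B \<longleftrightarrow> x \<in> A" for x
    using s by (metis bij_inv_eq_iff)
  define f :: "nat \<Rightarrow> int" where "f x = of_bool (x \<in> A \<union> B)" for x
  have "f x - f (Hilbert_Choice.inv s x) = of_bool (x \<in> B)" for x
    using inv[of x] assms(4) by (auto simp: f_def)
  moreover have "\<bar>f x\<bar> \<le> 1" for x
    by (simp add: f_def)
  ultimately show thesis
    using that s(1) by blast
qed

text \<open>The constant 1 is the sum of the indicators of the evens and the odds. Each is a
  difference as above: the evens are absorbed using the residues 1 and 3 modulo 4, the odds using 0
  and 2.\<close>

lemma ex_paradoxical:
  obtains s t and f g :: "nat \<Rightarrow> int"
  where "bij s" "bij t" "\<forall>x. \<bar>f x\<bar> \<le> 1" "\<forall>x. \<bar>g x\<bar> \<le> 1"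
    "\<forall>x. (f x - f (Hilbert_Choice.inv s x)) + (g x - g (Hilbert_Choice.inv t x)) = 1"
proof -
  have inf: "infinite {n::nat. n mod 4 = i}" if "i < 4" for i
  proof -
    have "range (\<lambda>n. 4 * n + i) \<subseteq> {n. n mod 4 = i}"
      using that by auto
    moreover have "infinite (range (\<lambda>n. 4 * n + i))"
      by (rule range_inj_infinite) (auto simp: inj_def)
    ultimately show ?thesis
      using finite_subset by blast
  qed
  obtain s and f :: "nat \<Rightarrow> int" where s: "bij s" "\<And>x. \<bar>f x\<bar> \<le> 1"
    "\<And>x. f x - f (Hilbert_Choice.inv s x) = of_bool (x \<in> {n. even n})"
    by (rule ex_indicator_difference[of "{n. n mod 4 = 1}" "{n. n mod 4 = 3}" "{n. even n}"])
      (use inf in \<open>auto, presburger+\<close>)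
  obtain t and g :: "nat \<Rightarrow> int" where t: "bij t" "\<And>x. \<bar>g x\<bar> \<le> 1"
    "\<And>x. g x - g (Hilbert_Choice.inv t x) = of_bool (x \<in> {n. odd n})"
    by (rule ex_indicator_difference[of "{n. n mod 4 = 0}" "{n. n mod 4 = 2}" "{n. odd n}"])
      (use inf in \<open>auto, presburger+\<close>)
  show thesis
    by (rule that[of s t f g]) (use s t in auto)
qed

section \<open>Countability and finite generation\<close>

text \<open>Each generated element is the product of a finite word in the generators and their
  inverses. Countability is what permits the quotient group to be carried by
  \<open>nat\<close>.\<close>

lemma (in group) countable_generate:
  assumes "countable S" "S \<subseteq> carrier G"
  shows "countable (generate G S)"
proof -
  let ?T = "insert \<one> (S \<union> (\<lambda>x. inv x) ` S)"
  let ?p = "\<lambda>xs. foldr (\<otimes>) xs \<one>"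
  have T: "?T \<subseteq> carrier G"
    using assms by auto
  have closed: "?p xs \<in> carrier G" if "xs \<in> lists ?T" for xs
    using that T by (induction xs) auto
  have append: "?p (xs @ ys) = ?p xs \<otimes> ?p ys" if "xs \<in> lists ?T" "ys \<in> lists ?T" for xs ys
    using that(1)
  proof (induction xs)
    case (Cons x xs)
    have "x \<in> carrier G" "?p xs \<in> carrier G" "?p ys \<in> carrier G"
      using Cons.hyps T closed that(2) by blast+
    then show ?case
      using Cons.IH by (simp add: m_assoc)
  qed (simp add: closed that(2))
  have single: "x \<in> ?p ` lists ?T" if "x \<in> ?T" for x
    using that T by (intro image_eqI[of _ _ "[x]"]) auto
  have "generate G S \<subseteq> ?p ` lists ?T"
  proof
    fix x assume "x \<in> generate G S"
    then show "x \<in> ?p ` lists ?T"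
    proof induction
      case (eng x y)
      then obtain xs ys where "xs \<in> lists ?T" "ys \<in> lists ?T" "x = ?p xs" "y = ?p ys"
        by blast
      then show ?case
        using append by (intro image_eqI[of _ _ "xs @ ys"]) auto
    qed (rule single; simp)+
  qed
  moreover have "countable (?p ` lists ?T)"
    using assms(1) by simp
  ultimately show ?thesis
    by (rule countable_subset)
qed

lemma finitely_generated_group_hom_image:
  assumes "group_hom E G p" "p ` carrier E = carrier G"
    and "finite S" "S \<subseteq> carrier E" "generate E S = carrier E"
  shows "finitely_generated_group G"
proof -
  interpret group_hom E G p by fact
  show ?thesis
    using generate_img[OF assms(4)] assms H.group_axioms
    unfolding finitely_generated_group_def
    by (intro conjI exI[of _ "p ` S"]) auto
qed

section \<open>The quotient by the shifts and its cocycle\<close>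

definition fibre_coordinate :: "(nat \<times> int \<Rightarrow> nat \<times> int) \<Rightarrow> int" where
  "fibre_coordinate u = snd (u (0, 0))"

text \<open>The representative with fibre coordinate 0 of the coset of \<open>u\<close> modulo all
  shifts.\<close>

definition normalize_fibre :: "(nat \<times> int \<Rightarrow> nat \<times> int) \<Rightarrow> nat \<times> int \<Rightarrow> nat \<times> int" where
  "normalize_fibre u = shift (- fibre_coordinate u) \<circ> u"

lemma shift_shift: "shift j \<circ> shift k = shift (j + k)" "shift j \<circ> (shift k \<circ> u) = shift (j + k) \<circ> u"
  by (auto simp: shift_def fun_eq_iff split: prod.splits)

lemma shift_0: "shift 0 = id"
  by (auto simp: shift_def)

lemma fibre_coordinate_shift:
  "fibre_coordinate (shift k \<circ> u) = fibre_coordinate u + k" "fibre_coordinate (shift k) = k"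
  by (auto simp: fibre_coordinate_def shift_def split: prod.splits)

lemma normalize_fibre_shift:
  "normalize_fibre (shift k \<circ> u) = normalize_fibre u" "normalize_fibre (shift k) = id"
  by (simp_all add: normalize_fibre_def fibre_coordinate_shift shift_shift shift_0)

text \<open>The correcting shift of \<open>v\<close> slides past \<open>u\<close> by equivariance
  and merges with that of \<open>u\<close>.\<close>

lemma normalize_fibre_comp:
  assumes "u \<in> carrier equivariant_group"
  shows "normalize_fibre u \<circ> normalize_fibre v
    = shift (- fibre_coordinate u - fibre_coordinate v) \<circ> (u \<circ> v)"
proof -
  have "u \<circ> shift k = shift k \<circ> u" for k
    using assms by (simp add: equivariant_group_def)
  then have "u \<circ> (shift k \<circ> v) = shift k \<circ> (u \<circ> v)" for k
    by (metis comp_assoc)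
  then show ?thesis
    by (simp add: normalize_fibre_def comp_assoc shift_shift)
qed

text \<open>The error term sees \<open>u\<close> and \<open>v\<close> only through their normal
  forms, so it descends to a cocycle on the quotient.\<close>

lemma fibre_coordinate_comp:
  assumes "u \<in> carrier equivariant_group"
  shows "fibre_coordinate (u \<circ> v) = fibre_coordinate u + fibre_coordinate v
    + fibre_coordinate (normalize_fibre u \<circ> normalize_fibre v)"
  by (simp add: normalize_fibre_comp[OF assms] fibre_coordinate_shift)

text \<open>The quotient by the central subgroup of shifts, with the cosets coded by natural numbers.\<close>

lemma quotient_by_shifts:
  assumes "subgroup C equivariant_group" "countable C"
  obtains G :: "nat monoid" and p w where
    "group_hom (equivariant_group\<lparr>carrier := C\<rparr>) G p" "p ` C = carrier G"
    "\<forall>u\<in>C. \<forall>v\<in>C.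
       fibre_coordinate (u \<circ> v) = fibre_coordinate u + fibre_coordinate v + w (p u) (p v)"
    "\<forall>k. p (shift k) = \<one>\<^bsub>G\<^esub>"
proof -
  let ?E = "equivariant_group\<lparr>carrier := C\<rparr> :: (nat \<times> int \<Rightarrow> nat \<times> int) monoid"
  interpret subgroup C equivariant_group by fact
  interpret E: group ?E
    by (rule subgroup_is_group) (rule group_equivariant_group)
  \<comment> \<open>Normal forms serve only as names of cosets: they need not lie in
    \<open>C\<close>, which is not assumed to contain the shifts.\<close>
  define N where "N = normalize_fibre ` C"
  define p where "p u = to_nat_on N (normalize_fibre u)" for u
  define r where "r = from_nat_into N"
  define w where "w a b = fibre_coordinate (r a \<circ> r b)" for a b
  define G :: "nat monoid" where
    "G = \<lparr>carrier = p ` C, monoid.mult = (\<lambda>a b. p (r a \<circ> r b)), one = p id\<rparr>"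
  have r: "r (p u) = normalize_fibre u" if "u \<in> C" for u
    unfolding r_def p_def by (rule from_nat_into_to_nat_on) (use that assms(2) in \<open>auto simp: N_def\<close>)
  have p_comp: "p (normalize_fibre u \<circ> normalize_fibre v) = p (u \<circ> v)" if "u \<in> C" for u v
    using normalize_fibre_comp[of u v] subset that
    by (auto simp: p_def normalize_fibre_shift)
  have hom: "p \<in> hom ?E G"
    using m_closed by (auto simp: hom_def G_def r p_comp)
  \<comment> \<open>The group axioms are inherited through the surjection \<open>p\<close> instead
    of being checked on codes.\<close>
  have "group (G\<lparr>carrier := p ` carrier ?E, one := p \<one>\<^bsub>?E\<^esub>\<rparr>)"
    by (rule E.hom_imp_img_group[OF hom])
  then have "group G"
    by (simp add: G_def)
  show thesis
  proof (rule that)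
    show "group_hom ?E G p"
      using \<open>group G\<close> hom by (intro group_hom.intro group_hom_axioms.intro E.group_axioms)
    show "p ` C = carrier G"
      by (simp add: G_def)
    show "\<forall>u\<in>C. \<forall>v\<in>C.
       fibre_coordinate (u \<circ> v) = fibre_coordinate u + fibre_coordinate v + w (p u) (p v)"
      using fibre_coordinate_comp subset by (auto simp: w_def r)
    show "\<forall>k. p (shift k) = \<one>\<^bsub>G\<^esub>"
      using normalize_fibre_shift(2) normalize_fibre_shift(2)[of 0]
      by (simp add: G_def p_def shift_0)
  qed
qed

text \<open>Replacing \<open>f\<close> and \<open>g\<close> by \<open>n\<close> times themselves
  scales the identity \<open>one\<close> by \<open>n\<close>, so two commutators suffice however
  large \<open>n\<close> is.\<close>

lemma shift_eq_commutators:
  fixes f g :: "nat \<Rightarrow> int"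
  assumes C: "subgroup C equivariant_group"
    and "bij s" "bij t"
    and one: "\<forall>x. (f x - f (Hilbert_Choice.inv s x)) + (g x - g (Hilbert_Choice.inv t x)) = 1"
    and mem: "fibre_map f \<in> C" "fibre_map g \<in> C" "base_map s \<in> C" "base_map t \<in> C"
  shows "\<exists>a\<in>C. \<exists>b\<in>C. \<exists>c\<in>C. \<exists>d\<in>C.
    commutator (equivariant_group\<lparr>carrier := C\<rparr>) a b \<circ> commutator (equivariant_group\<lparr>carrier := C\<rparr>) c d
      = shift (int n)"
proof -
  interpret subgroup C equivariant_group by fact
  have pow: "fibre_map (\<lambda>x. int n * h x) \<in> C" if "fibre_map h \<in> C" for h
  proof (induction n)
    case 0
    then show ?case
      using one_closed by (simp add: fibre_map_def id_def case_prod_beta)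
  next
    case (Suc n)
    have "fibre_map (\<lambda>x. int (Suc n) * h x) = fibre_map h \<circ> fibre_map (\<lambda>x. int n * h x)"
      by (auto simp: fibre_map_def algebra_simps)
    then show ?case
      using m_closed[OF that Suc] by (simp only: equivariant_group_simps)
  qed
  have comm: "commutator (equivariant_group\<lparr>carrier := C\<rparr>) (fibre_map (\<lambda>x. int n * h x)) (base_map r)
      = fibre_map (\<lambda>x. int n * (h x - h (Hilbert_Choice.inv r x)))"
    if "bij r" "fibre_map h \<in> C" "base_map r \<in> C" for h r
    using that pow[OF that(2)] mem_carrier commutator_fibre_base[of r "\<lambda>x. int n * h x"]
    by (simp add: commutator_def group.m_inv_consistent[OF group_equivariant_group C]
        m_inv_equivariant_group right_diff_distrib comp_assoc)
  have "int n * (f x - f (Hilbert_Choice.inv s x)) + int n * (g x - g (Hilbert_Choice.inv t x)) = int n" for x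
    unfolding distrib_left[symmetric] using one by simp
  then have "fibre_map (\<lambda>x. int n * (f x - f (Hilbert_Choice.inv s x)))
      \<circ> fibre_map (\<lambda>x. int n * (g x - g (Hilbert_Choice.inv t x))) = shift (int n)"
    by (auto simp: fibre_map_def shift_def fun_eq_iff add.commute)
  then show ?thesis
    unfolding comm[OF assms(2) mem(1,3), symmetric] comm[OF assms(3) mem(2,4), symmetric]
    using pow[OF mem(1)] pow[OF mem(2)] mem(3,4) by blast
qed

section \<open>The finitely generated group and both coefficient rings\<close>

theorem corollary15:
  shows "\<exists>G :: nat monoid. finitely_generated_group G \<and>
    \<not> exact_at
        (bounded_cohomology G 2 :: (nat list \<Rightarrow> real) set monoid) (comparison_map G 2)
        (ordinary_cohomology G 2 :: (nat list \<Rightarrow> real) set monoid) (iota_map G 2)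
        (linfty_cohomology G 2 :: (nat list \<Rightarrow> nat \<Rightarrow> real) set monoid) \<and>
    \<not> exact_at
        (bounded_cohomology G 2 :: (nat list \<Rightarrow> int) set monoid) (comparison_map G 2)
        (ordinary_cohomology G 2 :: (nat list \<Rightarrow> int) set monoid) (iota_map G 2)
        (linfty_cohomology G 2 :: (nat list \<Rightarrow> nat \<Rightarrow> int) set monoid)"
proof -
  obtain s t and f g :: "nat \<Rightarrow> int" where st: "bij s" "bij t"
    and bounds: "\<forall>x. \<bar>f x\<bar> \<le> 1" "\<forall>x. \<bar>g x\<bar> \<le> 1"
    and one: "\<forall>x. (f x - f (Hilbert_Choice.inv s x)) + (g x - g (Hilbert_Choice.inv t x)) = 1"
    by (rule ex_paradoxical)
  interpret U: group "equivariant_group :: (nat \<times> int \<Rightarrow> nat \<times> int) monoid"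
    by (rule group_equivariant_group)
  define S where "S = {fibre_map f, fibre_map g, base_map s, base_map t}"
  have S: "finite S" "S \<subseteq> carrier equivariant_group"
    unfolding S_def using st bounds
    by (auto intro: fibre_map_in_equivariant_group base_map_in_equivariant_group)
  define C where "C = generate equivariant_group S"
  have C: "subgroup C equivariant_group"
    unfolding C_def using S(2) by (rule U.generate_is_subgroup)
  have "countable C"
    unfolding C_def using S by (intro U.countable_generate) (auto simp: countable_finite)
  let ?E = "equivariant_group\<lparr>carrier := C\<rparr> :: (nat \<times> int \<Rightarrow> nat \<times> int) monoid"
  obtain G :: "nat monoid" and p w where hom: "group_hom ?E G p" and onto: "p ` C = carrier G"
    and coordinate: "\<forall>u\<in>C. \<forall>v\<in>C.
       fibre_coordinate (u \<circ> v) = fibre_coordinate u + fibre_coordinate v + w (p u) (p v)"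
    and p_shift: "\<forall>k. p (shift k) = \<one>\<^bsub>G\<^esub>"
    by (rule quotient_by_shifts[OF C \<open>countable C\<close>])
  have SC: "S \<subseteq> C"
    unfolding C_def by (auto intro: generate.incl)
  have "generate ?E S = C"
    using U.generate_consistent[OF SC C] unfolding C_def .
  then have fg: "finitely_generated_group G"
    using finitely_generated_group_hom_image[OF hom _ S(1)] onto SC by simp
  \<comment> \<open>The argument is uniform in the coefficients and requires only that the naturals
    be unbounded in them, so \<open>real\<close> and \<open>int\<close> are instances for the same
    \<open>G\<close>.\<close>
  have not_exact: "\<not> exact_at
        (bounded_cohomology G 2 :: (nat list \<Rightarrow> 'm) set monoid) (comparison_map G 2)
        (ordinary_cohomology G 2 :: (nat list \<Rightarrow> 'm) set monoid) (iota_map G 2)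
        (linfty_cohomology G 2 :: (nat list \<Rightarrow> nat \<Rightarrow> 'm) set monoid)"
    if "\<And>K::'m::linordered_idom. \<exists>n. K < of_nat n"
  proof (rule not_exact_at_if_central_extension[OF hom, of fibre_coordinate w])
    show "\<exists>K. \<forall>v\<in>carrier ?E. \<bar>fibre_coordinate (u \<otimes>\<^bsub>?E\<^esub> v) - fibre_coordinate v\<bar> \<le> K"
      if u: "u \<in> carrier ?E" for u
    proof -
      have "u \<in> carrier equivariant_group"
        using subgroup.mem_carrier[OF C] u by simp
      then obtain K where "\<forall>z. \<bar>snd (u z) - snd z\<bar> \<le> K"
        by (auto simp: equivariant_group_def simp del: split_paired_All)
      \<comment> \<open>The uniform bound is applied at the point \<open>v (0, 0)\<close>, for every
        \<open>v\<close> at once.\<close>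
      then show ?thesis
        by (intro exI[of _ K]) (auto simp: fibre_coordinate_def simp del: split_paired_All)
    qed
    show "\<exists>a\<in>carrier ?E. \<exists>b\<in>carrier ?E. \<exists>c\<in>carrier ?E. \<exists>d\<in>carrier ?E.
      p (commutator ?E a b \<otimes>\<^bsub>?E\<^esub> commutator ?E c d) = \<one>\<^bsub>G\<^esub> \<and>
      fibre_coordinate (commutator ?E a b \<otimes>\<^bsub>?E\<^esub> commutator ?E c d) = int n" for n
    proof -
      have "fibre_map f \<in> C" "fibre_map g \<in> C" "base_map s \<in> C" "base_map t \<in> C"
        using SC by (auto simp: S_def)
      from shift_eq_commutators[OF C st one this, of n]
      obtain a b c d where "a \<in> C" "b \<in> C" "c \<in> C" "d \<in> C"
        "commutator ?E a b \<circ> commutator ?E c d = shift (int n)"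
        by (elim bexE)
      then show ?thesis
        by (intro bexI[of _ a] bexI[of _ b] bexI[of _ c] bexI[of _ d])
          (simp_all add: p_shift fibre_coordinate_shift)
    qed
  qed (use onto coordinate that in simp_all)
  have archimedean_int: "\<exists>n. K < of_nat n" for K :: int
    by (intro exI[of _ "nat (K + 1)"]) simp
  show ?thesis
    by (intro exI[of _ G] conjI fg not_exact reals_Archimedean2 archimedean_int)
qed

end
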